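(* Let $x_{k-1}<\hat x<x_k$ for some $k\in\{1,\ldots,N\}$ and let $\hat y,\hat z\in\mathbb{R}$. The attractor of the iterated function system $$\{I \times \mathbb{R}^2;\ \omega_n \ (n=1,2,\ldots, N,\ n\neq k),\ \omega_k^l,\ \omega_k^r \},$$ where $\omega_n=(L_n,F_n)$, $\omega_k^l =(L_k^l,F_k^l)$ and $\omega_k^r =(L_k^r,F_k^r)$, is the graph of a continuous function $\hat f:I\to\mathbb{R}^2$ passing through the generalized interpolation points $\widehat{\Delta} = \Delta \cup \{(\hat{x},\hat{y},\hat{z})\}$, where $\Delta=\{(x_i,y_i,z_i): i=0,1,\ldots,N\}$; that is, $\hat f(x_i)=(y_i,z_i)$ for $i=0,\ldots,N$ and $\hat f(\hat x)=(\hat y,\hat z)$.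
   Context: Data: real numbers $x_0<x_1<\dots<x_N$ with $N\ge 2$, real $y_i$, and real parameters $z_i$, $i=0,\ldots,N$; $I=[x_0,x_N]$, $I_n=[x_{n-1},x_n]$. For $n=1,\ldots,N$: $L_n:I\to I_n$, $L_n(x)=x_{n-1}+\frac{x_n-x_{n-1}}{x_N-x_0}(x-x_0)$, and $F_n:I\times\mathbb{R}^2\to\mathbb{R}^2$, $F_n(x,y,z)=(\alpha_n y+\beta_n z+p_n(x),\ \gamma_n z+q_n(x))$, where $|\alpha_n|<1$, $|\gamma_n|<1$, $|\beta_n|+|\gamma_n|<1$, and $p_n,q_n:I\to\mathbb{R}$ are continuous functions such that the join-up conditions $F_n(x_0,y_0,z_0)=(y_{n-1},z_{n-1})$ and $F_n(x_N,y_N,z_N)=(y_n,z_n)$ hold. For the inserted point $(\hat x,\hat y,\hat z)$ with $x_{k-1}<\hat x<x_k$: $L_k^l:I\to[x_{k-1},\hat x]$, $L_k^l(x)=x_{k-1}+\frac{\hat x-x_{k-1}}{x_N-x_0}(x-x_0)$; $L_k^r:I\to[\hat x,x_k]$, $L_k^r(x)=\hat x+\frac{x_k-\hat x}{x_N-x_0}(x-x_0)$; and for $s\in\{l,r\}$, $F_k^s:I\times\mathbb{R}^2\to\mathbb{R}^2$, $F_k^s(x,y,z)=(\alpha_k^s y+\beta_k^s z+p_k^s(x),\ \gamma_k^s z+q_k^s(x))$, where $|\alpha_k^s|<1$, $|\gamma_k^s|<1$, $|\beta_k^s|+|\gamma_k^s|<1$, and $p_k^s,q_k^s:I\to\mathbb{R}$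 are continuous functions such that $F_k^l(x_0,y_0,z_0)=(y_{k-1},z_{k-1})$, $F_k^l(x_N,y_N,z_N)=(\hat y,\hat z)$, $F_k^r(x_0,y_0,z_0)=(\hat y,\hat z)$, $F_k^r(x_N,y_N,z_N)=(y_k,z_k)$. Here $(L,F)$ denotes the map $(x,y,z)\mapsto (L(x),F(x,y,z))$ from $I\times\mathbb{R}^2$ to itself. The attractor of an IFS (a finite family of self-maps of $I\times\mathbb{R}^2$, all contractions with respect to a suitable complete metric equivalent to the Euclidean one) is the unique non-empty compact set equal to the union of its images under the maps of the family. The graph of $g:I\to\mathbb{R}^2$ is $\{(x,g(x)):x\in I\}\subset I\times\mathbb{R}^2$. *)

theory Defs
  imports "HOL-Analysis.Analysis"
begin

text \<open>Equivalence of metrics is topological equivalence. A Lipschitz equivalence would be too much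
  to ask for maps whose dependence on the first coordinate is merely continuous.\<close>

definition equivalent_complete_metric ::
  "'a::metric_space set \<Rightarrow> ('a \<Rightarrow> 'a \<Rightarrow> real) \<Rightarrow> bool" where
  "equivalent_complete_metric X d \<longleftrightarrow>
     Metric_space X d \<and> Metric_space.mcomplete X d \<and>
     Metric_space.mtopology X d = top_of_set X"

definition contraction_wrt ::
  "'a set \<Rightarrow> ('a \<Rightarrow> 'a \<Rightarrow> real) \<Rightarrow> ('a \<Rightarrow> 'a) \<Rightarrow> bool" where
  "contraction_wrt X d w \<longleftrightarrow>
     (\<exists>c. 0 \<le> c \<and> c < 1 \<and> (\<forall>u\<in>X. \<forall>v\<in>X. d (w u) (w v) \<le> c * d u v))"

definition is_IFS :: "'a::metric_space set \<Rightarrow> ('a \<Rightarrow> 'a) set \<Rightarrow> bool" where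
  "is_IFS X W \<longleftrightarrow>
     finite W \<and> (\<forall>w\<in>W. w ` X \<subseteq> X) \<and>
     (\<exists>d. equivalent_complete_metric X d \<and> (\<forall>w\<in>W. contraction_wrt X d w))"

definition invariant_compact :: "'a::metric_space set \<Rightarrow> ('a \<Rightarrow> 'a) set \<Rightarrow> 'a set \<Rightarrow> bool" where
  "invariant_compact X W A \<longleftrightarrow>
     A \<noteq> {} \<and> A \<subseteq> X \<and> compact A \<and> A = (\<Union>w\<in>W. w ` A)"

definition is_attractor :: "'a::metric_space set \<Rightarrow> ('a \<Rightarrow> 'a) set \<Rightarrow> 'a set \<Rightarrow> bool" where
  "is_attractor X W A \<longleftrightarrow>
     is_IFS X W \<and> invariant_compact X W A \<and> (\<forall>B. invariant_compact X W B \<longrightarrow> B = A)"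

text \<open>The affine map taking the interval from \<open>a\<close> to \<open>b\<close> onto the interval from \<open>u\<close> to \<open>v\<close>.\<close>

definition L_map :: "real \<Rightarrow> real \<Rightarrow> real \<Rightarrow> real \<Rightarrow> real \<Rightarrow> real" where
  "L_map a b u v t = u + (v - u) / (b - a) * (t - a)"

definition F_map ::
  "real \<Rightarrow> real \<Rightarrow> real \<Rightarrow> (real \<Rightarrow> real) \<Rightarrow> (real \<Rightarrow> real) \<Rightarrow> real \<Rightarrow> real \<times> real \<Rightarrow> real \<times> real" where
  "F_map \<alpha> \<beta> \<gamma> p q t = (\<lambda>(y, z). (\<alpha> * y + \<beta> * z + p t, \<gamma> * z + q t))"

definition pair_map ::
  "(real \<Rightarrow> real) \<Rightarrow> (real \<Rightarrow> real \<times> real \<Rightarrow> real \<times> real) \<Rightarrow> real \<times> real \<times> real \<Rightarrow> real \<times> real \<times> real" where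
  "pair_map L F = (\<lambda>(t, v). (L t, F t v))"

definition graph_on :: "'a set \<Rightarrow> ('a \<Rightarrow> 'b) \<Rightarrow> ('a \<times> 'b) set" where
  "graph_on S g = {(t, g t) | t. t \<in> S}"

end

theory Submission
  imports Defs
begin

text \<open>The attractor is the graph of the fixed point \<open>f\<close> of the Read-Bajraktarevic operator of the
  refined node set. That operator is triangular: the second coordinate of \<open>f\<close> is a scalar fixed point
  by itself, and once it is known it only contributes a continuous inhomogeneity to the equation for
  the first coordinate. After the shear \<open>(t, v) \<mapsto> (t, v - f t)\<close> the merely continuous functions
  \<open>p\<close> and \<open>q\<close> disappear and every map of the system becomes linear in the fibre, so the
  \<open>\<ell>\<^sup>1\<close> metric in the sheared coordinates makes all maps contractions. Contractivity in turn forces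
  the invariant compact set to be unique.\<close>

section \<open>Uniqueness of the invariant compact set\<close>

text \<open>Every point of \<open>A\<close> is the image of a point of \<open>A\<close> under
  arbitrarily long compositions of maps of \<open>W\<close>. The same composition applied to a point
  of \<open>B\<close> stays in \<open>B\<close> and lands geometrically close, and \<open>B\<close>
  is closed. Exchanging \<open>A\<close> and \<open>B\<close> gives equality.\<close>

lemma invariant_compact_subset:
  assumes IFS: "is_IFS X W" and A: "invariant_compact X W A" and B: "invariant_compact X W B"
  shows "A \<subseteq> B"
proof -
  obtain d where d: "equivalent_complete_metric X d" and con: "\<And>w. w \<in> W \<Longrightarrow> contraction_wrt X d w"
    and finW: "finite W"
    using IFS unfolding is_IFS_def by blast
  interpret Metric_space X d
    using d by (simp add: equivalent_complete_metric_def)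
  have top: "mtopology = top_of_set X"
    using d by (simp add: equivalent_complete_metric_def)
  have AX: "A \<subseteq> X" and BX: "B \<subseteq> X" and A_eq: "A = (\<Union>w\<in>W. w ` A)" and B_eq: "B = (\<Union>w\<in>W. w ` B)"
    and "A \<noteq> {}" and "B \<noteq> {}"
    using A B unfolding invariant_compact_def by auto
  have compA: "compactin mtopology A" and compB: "compactin mtopology B"
    using A B unfolding invariant_compact_def top by (simp_all add: compactin_subtopology)
  have "\<exists>c. \<forall>w\<in>W. 0 \<le> c w \<and> c w < 1 \<and> (\<forall>u\<in>X. \<forall>v\<in>X. d (w u) (w v) \<le> c w * d u v)"
    using con unfolding contraction_wrt_def by (intro bchoice) blast
  then obtain c where c: "\<And>w. w \<in> W \<Longrightarrow> 0 \<le> c w \<and> c w < 1 \<and> (\<forall>u\<in>X. \<forall>v\<in>X. d (w u) (w v) \<le> c w * d u v)"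
    by blast
  \<comment> \<open>The inserted 0 keeps \<open>Max\<close> defined whatever \<open>W\<close> is and
    yields \<open>0 \<le> C\<close>.\<close>
  define C where "C = Max (insert 0 (c ` W))"
  have C0: "0 \<le> C" and C1: "C < 1" and cC: "\<And>w. w \<in> W \<Longrightarrow> c w \<le> C"
    using finW c by (auto simp: C_def)
  have "compactin mtopology (A \<union> B)"
    using compA compB by (rule compactin_Un)
  \<comment> \<open>Compactness bounds all distances between \<open>A\<close> and \<open>B\<close>
    at once; \<open>D\<close> is the start of the geometric decay.\<close>
  then obtain D where D: "\<And>a b. a \<in> A \<union> B \<Longrightarrow> b \<in> A \<union> B \<Longrightarrow> d a b \<le> D"
    using compactin_imp_mbounded mbounded_alt by metis
  have near: "\<exists>b\<in>B. d a b \<le> C ^ n * D" if "a \<in> A" for a n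
    using that
  proof (induction n arbitrary: a)
    case 0
    then show ?case
      using \<open>B \<noteq> {}\<close> D by auto
  next
    case (Suc n)
    then obtain w a' where w: "w \<in> W" "a' \<in> A" "a = w a'"
      using A_eq by blast
    then obtain b where b: "b \<in> B" "d a' b \<le> C ^ n * D"
      using Suc.IH by blast
    have "d a (w b) \<le> c w * d a' b"
      using c w b AX BX by blast
    also have "\<dots> \<le> C * (C ^ n * D)"
      using cC[OF w(1)] b(2) C0 by (intro mult_mono) auto
    finally show ?case
      using w b B_eq by (auto simp: mult.assoc)
  qed
  have lim: "(\<lambda>n. C ^ n * D) \<longlonglongrightarrow> 0"
    using tendsto_mult_left_zero[OF LIMSEQ_power_zero[of C]] C0 C1 by simp
  have "closedin mtopology B"
    using compB Hausdorff_space_mtopology compactin_imp_closedin by blast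
  moreover have "a \<in> mtopology closure_of B" if "a \<in> A" for a
  proof -
    have "\<exists>y\<in>B. y \<in> mball a r" if r: "0 < r" for r
    proof -
      obtain n where "C ^ n * D < r"
        using eventually_happens'[OF sequentially_bot order_tendstoD(2)[OF lim r]] by blast
      then show ?thesis
        using near[OF \<open>a \<in> A\<close>, of n] \<open>a \<in> A\<close> AX BX by force
    qed
    then show ?thesis
      using that AX by (auto simp: metric_closure_of)
  qed
  ultimately show ?thesis
    by (auto simp: closure_of_closedin)
qed

section \<open>Metrics pulled back along a homeomorphism\<close>

text \<open>\<open>lower\<close> and \<open>upper\<close> compare \<open>d\<close> with the
  Euclidean distance after applying \<open>\<Phi>\<close>, which transfers completeness. For the
  Euclidean distance on \<open>X\<close> itself \<open>\<Phi>\<close> is only a homeomorphism, so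
  the topologies agree without a Lipschitz comparison of \<open>d\<close> with \<open>dist\<close>
  on \<open>X\<close>.\<close>

lemma equivalent_complete_metric_pullback:
  fixes \<Phi> :: "'a::metric_space \<Rightarrow> 'b::metric_space"
  assumes hom: "homeomorphism X Y \<Phi> \<Psi>" and Y: "complete Y"
    and metric: "Metric_space X d"
    and lower: "\<And>u v. u \<in> X \<Longrightarrow> v \<in> X \<Longrightarrow> dist (\<Phi> u) (\<Phi> v) \<le> d u v"
    and upper: "\<And>u v. u \<in> X \<Longrightarrow> v \<in> X \<Longrightarrow> d u v \<le> C * dist (\<Phi> u) (\<Phi> v)"
  shows "equivalent_complete_metric X d"
proof -
  interpret Metric_space X d by (rule metric)
  have \<Phi>: "\<And>u. u \<in> X \<Longrightarrow> \<Phi> u \<in> Y" and \<Psi>: "\<And>v. v \<in> Y \<Longrightarrow> \<Psi> v \<in> X"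
    and \<Psi>\<Phi>: "\<And>u. u \<in> X \<Longrightarrow> \<Psi> (\<Phi> u) = u" and \<Phi>\<Psi>: "\<And>v. v \<in> Y \<Longrightarrow> \<Phi> (\<Psi> v) = v"
    and cont: "continuous_on X \<Phi>"
    using hom unfolding homeomorphism_def by auto
  \<comment> \<open>No sign is assumed for \<open>C\<close>; \<open>K\<close> is positive and can be
    divided by.\<close>
  define K where "K = max C 1"
  have K: "K > 0" and upperK: "\<And>u v. u \<in> X \<Longrightarrow> v \<in> X \<Longrightarrow> d u v \<le> K * dist (\<Phi> u) (\<Phi> v)"
    by (auto simp: K_def intro: order_trans[OF upper mult_right_mono])
  \<comment> \<open>\<open>\<Phi>\<close> maps open sets to open sets, so a Euclidean ball about
    \<open>\<Phi> u\<close> gives, by \<open>lower\<close>, a \<open>d\<close>-ball inside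
    \<open>U\<close>. The converse below uses continuity of \<open>\<Phi>\<close> and
    \<open>upperK\<close>.\<close>
  have open_if: "openin mtopology U" if "openin (top_of_set X) U" for U
    unfolding openin_mtopology
  proof (intro conjI allI impI)
    show UX: "U \<subseteq> X" using that openin_imp_subset by blast
    fix u assume u: "u \<in> U"
    have "openin (top_of_set Y) (\<Phi> ` U)"
      by (rule homeomorphism_imp_open_map[OF hom that])
    then obtain e where e: "e > 0" "\<And>v. v \<in> Y \<Longrightarrow> dist v (\<Phi> u) < e \<Longrightarrow> v \<in> \<Phi> ` U"
      unfolding openin_euclidean_subtopology_iff using u by blast
    have "v \<in> U" if v: "v \<in> mball u e" for v
    proof -
      have "\<Phi> v \<in> \<Phi> ` U"
        using e(2)[of "\<Phi> v"] v lower[of u v] \<Phi> by (auto simp: dist_commute)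
      then show ?thesis
        using UX v \<Psi>\<Phi> by (metis imageE in_mball subsetD)
    qed
    then show "\<exists>r>0. mball u r \<subseteq> U" using e(1) by blast
  qed
  have open_only_if: "openin (top_of_set X) U" if U: "openin mtopology U" for U
    unfolding openin_euclidean_subtopology_iff
  proof (intro conjI ballI)
    show UX: "U \<subseteq> X" using U openin_mtopology by blast
    fix u assume u: "u \<in> U"
    obtain r where r: "r > 0" "mball u r \<subseteq> U"
      using U u openin_mtopology by blast
    have "u \<in> X" "r / K > 0" using u UX r K by auto
    then obtain e where e: "e > 0" "\<And>v. v \<in> X \<Longrightarrow> dist v u < e \<Longrightarrow> dist (\<Phi> v) (\<Phi> u) < r / K"
      using cont unfolding continuous_on_iff by metis
    have "v \<in> U" if v: "v \<in> X" "dist v u < e" for v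
    proof -
      have "d u v < r"
        using upperK[OF \<open>u \<in> X\<close> v(1)] e(2)[OF v] K by (simp add: field_simps dist_commute)
      then show ?thesis using r v \<open>u \<in> X\<close> by auto
    qed
    then show "\<exists>e>0. \<forall>v\<in>X. dist v u < e \<longrightarrow> v \<in> U" using e(1) by blast
  qed
  have "mtopology = top_of_set X"
    using open_if open_only_if by (auto simp: topology_eq)
  moreover have mcomplete
    unfolding mcomplete_def
  proof (intro allI impI)
    fix \<sigma> assume \<sigma>: "MCauchy \<sigma>"
    then have \<sigma>X: "\<sigma> n \<in> X" for n by (auto simp: MCauchy_def)
    \<comment> \<open>\<open>lower\<close> sends Cauchy sequences into the complete set
      \<open>Y\<close>; \<open>upperK\<close> pulls the limit back through
      \<open>\<Psi>\<close>.\<close>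
    have "Cauchy (\<Phi> \<circ> \<sigma>)"
      unfolding Cauchy_def
    proof (intro allI impI)
      fix e :: real assume "e > 0"
      then obtain M where "\<And>m n. m \<ge> M \<Longrightarrow> n \<ge> M \<Longrightarrow> d (\<sigma> m) (\<sigma> n) < e"
        using \<sigma> unfolding MCauchy_def by blast
      then show "\<exists>M. \<forall>m\<ge>M. \<forall>n\<ge>M. dist ((\<Phi> \<circ> \<sigma>) m) ((\<Phi> \<circ> \<sigma>) n) < e"
        using lower[OF \<sigma>X \<sigma>X] by (metis comp_apply le_less_trans)
    qed
    moreover have "\<forall>n. (\<Phi> \<circ> \<sigma>) n \<in> Y"
      using \<Phi> \<sigma>X by simp
    ultimately obtain l where l: "l \<in> Y" "(\<Phi> \<circ> \<sigma>) \<longlonglongrightarrow> l"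
      using Y unfolding complete_def by blast
    have "limitin mtopology \<sigma> (\<Psi> l) sequentially"
      unfolding limit_metric_sequentially
    proof (intro conjI allI impI)
      show "\<Psi> l \<in> X" using l \<Psi> by blast
      fix e :: real assume "e > 0"
      then obtain M where M: "\<And>n. n \<ge> M \<Longrightarrow> dist (\<Phi> (\<sigma> n)) l < e / K"
        using l(2) K unfolding lim_sequentially by (metis comp_apply divide_pos_pos)
      have "d (\<sigma> n) (\<Psi> l) < e" if "n \<ge> M" for n
        using upperK[OF \<sigma>X[of n] \<Psi>[OF l(1)]] M[OF that] K \<Phi>\<Psi>[OF l(1)] by (simp add: field_simps)
      then show "\<exists>M. \<forall>n\<ge>M. \<sigma> n \<in> X \<and> d (\<sigma> n) (\<Psi> l) < e" using \<sigma>X by blast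
    qed
    then show "\<exists>x. limitin mtopology \<sigma> x sequentially" by blast
  qed
  ultimately show ?thesis
    using metric unfolding equivalent_complete_metric_def by blast
qed

section \<open>Affine maps between intervals\<close>

lemma L_map_left [simp]: "L_map a b u v a = u"
  by (simp add: L_map_def)

lemma L_map_right [simp]: "a \<noteq> b \<Longrightarrow> L_map a b u v b = v"
  by (simp add: L_map_def)

lemma L_map_inverse: "a \<noteq> b \<Longrightarrow> u \<noteq> v \<Longrightarrow> L_map u v a b (L_map a b u v t) = t"
  by (simp add: L_map_def)

lemma L_map_diff: "L_map a b u v s - L_map a b u v t = (v - u) / (b - a) * (s - t)"
proof -
  have "u + c * (s - a) - (u + c * (t - a)) = c * (s - t)" for c
    by (simp add: algebra_simps)
  then show ?thesis by (simp only: L_map_def)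
qed

lemma L_map_mem: "a < b \<Longrightarrow> u \<le> v \<Longrightarrow> t \<in> {a..b} \<Longrightarrow> L_map a b u v t \<in> {u..v}"
  using mult_left_mono[of "t - a" "b - a" "(v - u) / (b - a)"] by (auto simp: L_map_def)

lemma continuous_on_L_map: "continuous_on S (L_map a b u v)"
  unfolding L_map_def by (intro continuous_intros)

lemma L_map_image:
  assumes "a < b" "u < v"
  shows "L_map a b u v ` {a..b} = {u..v}"
proof
  show "L_map a b u v ` {a..b} \<subseteq> {u..v}"
    using L_map_mem[of a b u v] assms by auto
  show "{u..v} \<subseteq> L_map a b u v ` {a..b}"
  proof
    fix s assume "s \<in> {u..v}"
    then have "L_map u v a b s \<in> {a..b}"
      using assms by (intro L_map_mem) auto
    moreover have "s = L_map a b u v (L_map u v a b s)"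
      using L_map_inverse[of u v a b s] assms by simp
    ultimately show "s \<in> L_map a b u v ` {a..b}" by blast
  qed
qed

section \<open>The l1 metric in sheared coordinates\<close>

text \<open>The l1 operator norm is the largest column sum, and the columns of the fibre matrix have
  sums \<open>\<bar>\<alpha>\<bar>\<close> and
  \<open>\<bar>\<beta>\<bar> + \<bar>\<gamma>\<bar>\<close>, the two quantities assumed below 1. The
  Euclidean norm need not shrink under these bounds.\<close>

definition l1_norm :: "real \<times> real \<times> real \<Rightarrow> real" where
  "l1_norm = (\<lambda>(r, a, b). \<bar>r\<bar> + \<bar>a\<bar> + \<bar>b\<bar>)"

definition shear :: "(real \<Rightarrow> real \<times> real) \<Rightarrow> real \<times> real \<times> real \<Rightarrow> real \<times> real \<times> real" where
  "shear f = (\<lambda>(t, v). (t, v - f t))"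

lemma norm_le_l1_norm: "norm p \<le> l1_norm p"
proof -
  obtain r a b where p: "p = (r, a, b)" by (metis prod_cases3)
  have "norm p \<le> norm r + norm (a, b)" and "norm (a, b) \<le> norm a + norm b"
    unfolding p norm_Pair by (rule sqrt_sum_squares_le_sum; simp)+
  then show ?thesis by (simp add: p l1_norm_def)
qed

text \<open>Each of the three coordinates is at most the Euclidean norm. Together with
  \<open>norm_le_l1_norm\<close> this supplies the two bounds of
  \<open>equivalent_complete_metric_pullback\<close>.\<close>

lemma l1_norm_le_norm: "l1_norm p \<le> 3 * norm p"
proof -
  obtain r a b where p: "p = (r, a, b)" by (metis prod_cases3)
  have "norm r \<le> norm p" "norm (a, b) \<le> norm p" "norm a \<le> norm (a, b)" "norm b \<le> norm (a, b)"
    unfolding p using norm_fst_le norm_snd_le by (metis fst_conv snd_conv)+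
  then show ?thesis by (simp add: p l1_norm_def)
qed

lemma l1_norm_eq_0_iff: "l1_norm p = 0 \<longleftrightarrow> p = 0"
  by (cases p) (auto simp: l1_norm_def zero_prod_def)

lemma l1_norm_nonneg: "0 \<le> l1_norm p"
  by (cases p) (auto simp: l1_norm_def)

lemma l1_norm_minus_commute: "l1_norm (p - q) = l1_norm (q - p)"
  by (cases p; cases q) (auto simp: l1_norm_def)

lemma l1_norm_triangle: "l1_norm (p + q) \<le> l1_norm p + l1_norm q"
  by (cases p; cases q) (auto simp: l1_norm_def)

lemma homeomorphism_shear:
  assumes "continuous_on S f"
  shows "homeomorphism (S \<times> UNIV) (S \<times> UNIV) (shear f) (shear (\<lambda>t. - f t))"
proof -
  have *: "continuous_on (S \<times> UNIV) (shear g)" if "continuous_on S g" for g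
    unfolding shear_def split_beta
    by (intro continuous_intros continuous_on_compose2[OF that]) auto
  show ?thesis
    using *[OF assms] *[OF continuous_on_minus[OF assms]]
    by (intro homeomorphismI) (auto simp: shear_def)
qed

text \<open>The shear is a homeomorphism of the strip onto itself that turns this metric into the l1
  distance; the strip is complete because \<open>S\<close> is closed.\<close>

lemma equivalent_complete_metric_shear:
  assumes "continuous_on S f" "closed S"
  shows "equivalent_complete_metric (S \<times> UNIV) (\<lambda>u v. l1_norm (shear f u - shear f v))"
proof (rule equivalent_complete_metric_pullback[OF homeomorphism_shear[OF assms(1)]])
  show "complete (S \<times> (UNIV :: (real \<times> real) set))"
    using assms(2) by (simp add: complete_eq_closed closed_Times)
  show "Metric_space (S \<times> UNIV) (\<lambda>u v. l1_norm (shear f u - shear f v))"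
  proof
    fix u v w :: "real \<times> real \<times> real"
    show "l1_norm (shear f u - shear f v) = 0 \<longleftrightarrow> u = v"
      by (cases u; cases v) (auto simp: l1_norm_eq_0_iff shear_def zero_prod_def)
    show "l1_norm (shear f u - shear f w) \<le>
        l1_norm (shear f u - shear f v) + l1_norm (shear f v - shear f w)"
      using l1_norm_triangle[of "shear f u - shear f v" "shear f v - shear f w"] by simp
  qed (auto intro: l1_norm_nonneg l1_norm_minus_commute)
qed (auto simp: dist_norm intro: norm_le_l1_norm l1_norm_le_norm)

text \<open>In the sheared coordinates the map acts diagonally on the base and linearly on the fibre, by
  an upper triangular matrix whose \<open>\<ell>\<^sup>1\<close> operator norm is at most \<open>max \<bar>\<alpha>\<bar> (\<bar>\<beta>\<bar> + \<bar>\<gamma>\<bar>)\<close>; the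
  functions \<open>p\<close> and \<open>q\<close> cancel.\<close>

lemma contraction_pair_map:
  assumes "a < b" and "u \<le> v" and "v - u < b - a"
    and "\<bar>\<alpha>\<bar> < 1" and "\<bar>\<beta>\<bar> + \<bar>\<gamma>\<bar> < 1"
    and f: "\<And>t. t \<in> {a..b} \<Longrightarrow> f (L_map a b u v t) = F_map \<alpha> \<beta> \<gamma> p q t (f t)"
  shows "contraction_wrt ({a..b} \<times> UNIV) (\<lambda>s t. l1_norm (shear f s - shear f t))
    (pair_map (L_map a b u v) (F_map \<alpha> \<beta> \<gamma> p q))"
proof -
  define \<rho> where "\<rho> = (v - u) / (b - a)"
  define c where "c = Max {\<rho>, \<bar>\<alpha>\<bar>, \<bar>\<beta>\<bar> + \<bar>\<gamma>\<bar>}"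
  have le_c: "\<rho> \<le> c" "\<bar>\<alpha>\<bar> \<le> c" "\<bar>\<beta>\<bar> + \<bar>\<gamma>\<bar> \<le> c"
    unfolding c_def by (rule Max_ge; simp)+
  have "0 \<le> \<rho>" "\<rho> < 1"
    using assms by (auto simp: \<rho>_def)
  then have "0 \<le> c" "c < 1"
    using assms by (auto simp: c_def le_max_iff_disj)
  have lin: "l1_norm (\<rho> * r, \<alpha> * y + \<beta> * z, \<gamma> * z) \<le> c * l1_norm (r, y, z)" for r y z
  proof -
    have "l1_norm (\<rho> * r, \<alpha> * y + \<beta> * z, \<gamma> * z) \<le> \<rho> * \<bar>r\<bar> + \<bar>\<alpha>\<bar> * \<bar>y\<bar> + (\<bar>\<beta>\<bar> + \<bar>\<gamma>\<bar>) * \<bar>z\<bar>"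
      using abs_triangle_ineq[of "\<alpha> * y" "\<beta> * z"] \<open>0 \<le> \<rho>\<close>
      by (simp add: l1_norm_def abs_mult distrib_right)
    also have "\<dots> \<le> c * \<bar>r\<bar> + c * \<bar>y\<bar> + c * \<bar>z\<bar>"
      by (intro add_mono mult_right_mono le_c) auto
    finally show ?thesis
      by (simp add: l1_norm_def distrib_left)
  qed
  let ?w = "pair_map (L_map a b u v) (F_map \<alpha> \<beta> \<gamma> p q)"
  have "l1_norm (shear f (?w s) - shear f (?w t)) \<le> c * l1_norm (shear f s - shear f t)"
    if st: "s \<in> {a..b} \<times> UNIV" "t \<in> {a..b} \<times> UNIV" for s t
  proof -
    obtain s0 s1 s2 where s: "s = (s0, s1, s2)" by (metis prod_cases3)
    obtain t0 t1 t2 where t: "t = (t0, t1, t2)" by (metis prod_cases3)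
    obtain f1 f2 where fs: "f s0 = (f1, f2)" by fastforce
    obtain g1 g2 where ft: "f t0 = (g1, g2)" by fastforce
    define r y z where "r = s0 - t0" and "y = (s1 - f1) - (t1 - g1)" and "z = (s2 - f2) - (t2 - g2)"
    have 1: "shear f s - shear f t = (r, y, z)"
      by (simp add: s t shear_def fs ft r_def y_def z_def)
    \<comment> \<open>The equation for \<open>f\<close> removes \<open>p\<close> and
      \<open>q\<close> at each of the two points separately, so no modulus of continuity enters. The
      base coordinate scales by \<open>\<rho>\<close> because \<open>L_map\<close> is
      affine.\<close>
    have 2: "shear f (?w s) - shear f (?w t) = (\<rho> * r, \<alpha> * y + \<beta> * z, \<gamma> * z)"
      using st f[of s0] f[of t0] L_map_diff[of a b u v s0 t0]
      by (simp add: s t shear_def pair_map_def F_map_def fs ft r_def y_def z_def \<rho>_def algebra_simps)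
    show ?thesis
      unfolding 1 2 by (rule lin)
  qed
  then show ?thesis
    unfolding contraction_wrt_def using \<open>0 \<le> c\<close> \<open>c < 1\<close> by blast
qed

section \<open>Subdivided intervals\<close>

text \<open>To be instantiated with the refined nodes. Having at least two pieces makes each one
  strictly shorter than the whole interval, so that every \<open>L n\<close> contracts.\<close>

locale interpolation_nodes =
  fixes M :: nat and u :: "nat \<Rightarrow> real"
  assumes two_le: "2 \<le> M"
    and step: "i < M \<Longrightarrow> u i < u (Suc i)"
begin

abbreviation J :: "real set" where "J \<equiv> {u 0..u M}"

abbreviation L :: "nat \<Rightarrow> real \<Rightarrow> real" where
  "L n \<equiv> L_map (u 0) (u M) (u (n - 1)) (u n)"

lemma nodes_less: "i < j \<Longrightarrow> j \<le> M \<Longrightarrow> u i < u j"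
proof (induction j)
  case (Suc j)
  then show ?case
    using step[of j] by (cases "i = j") auto
qed simp

lemma nodes_le: "i \<le> j \<Longrightarrow> j \<le> M \<Longrightarrow> u i \<le> u j"
  using nodes_less[of i j] by (cases "i = j") auto

lemma endpoints: "u 0 < u M"
  using nodes_less[of 0 M] two_le by simp

lemma piece_subset: "n \<in> {1..M} \<Longrightarrow> {u (n - 1)..u n} \<subseteq> J"
  using nodes_le[of 0 "n - 1"] nodes_le[of n M] by auto

lemma piece_step: "n \<in> {1..M} \<Longrightarrow> u (n - 1) < u n"
  using nodes_less[of "n - 1" n] by auto

lemma piece_length:
  assumes "n \<in> {1..M}"
  shows "u n - u (n - 1) < u M - u 0"
\<comment> \<open>The spare room lies to the right of the first piece and to the left of any
  other.\<close>
proof (cases "n = 1")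
  case True
  then show ?thesis using nodes_less[of 1 M] two_le by simp
next
  case False
  then have "u 0 < u (n - 1)"
    using assms by (intro nodes_less) auto
  then show ?thesis
    using nodes_le[of n M] assms by auto
qed

lemma L_image: "n \<in> {1..M} \<Longrightarrow> L n ` J = {u (n - 1)..u n}"
  using L_map_image endpoints piece_step by metis

lemma L_in_J: "n \<in> {1..M} \<Longrightarrow> t \<in> J \<Longrightarrow> L n t \<in> J"
  using L_image piece_subset by blast

lemma ex_piece:
  assumes "s \<in> J"
  shows "\<exists>n\<in>{1..M}. s \<in> {u (n - 1)..u n}"
\<comment> \<open>At \<open>u 0\<close> the least index used below would be 0, which numbers no
  piece.\<close>
proof (cases "s = u 0")
  case True
  then show ?thesis using two_le nodes_le[of 0 1] by (intro bexI[of _ 1]) auto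
next
  case False
  define n where "n = (LEAST n. s \<le> u n)"
  have "s \<le> u n" "n \<le> M"
    using assms by (auto simp: n_def intro: LeastI Least_le)
  moreover have "n \<noteq> 0"
    using \<open>s \<le> u n\<close> assms False by (cases n) auto
  moreover have "u (n - 1) \<le> s"
    using not_less_Least[of "n - 1" "\<lambda>n. s \<le> u n"] \<open>n \<noteq> 0\<close> by (auto simp: n_def)
  ultimately show ?thesis by (intro bexI[of _ n]) auto
qed

lemma J_eq_Union_pieces: "J = (\<Union>n\<in>{1..M}. {u (n - 1)..u n})"
  using ex_piece piece_subset by blast

lemma J_eq_Union: "J = (\<Union>n\<in>{1..M}. L n ` J)"
  using J_eq_Union_pieces L_image by simp

text \<open>Adjacent pieces meet in one node, where \<open>join\<close> makes the choice of piece
  immaterial; continuity on finitely many closed sets passes to their union.\<close>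

lemma glue:
  fixes G :: "nat \<Rightarrow> real \<Rightarrow> real"
  assumes cont: "\<And>n. n \<in> {1..M} \<Longrightarrow> continuous_on {u (n - 1)..u n} (G n)"
    and join: "\<And>n. 1 \<le> n \<Longrightarrow> n < M \<Longrightarrow> G n (u n) = G (Suc n) (u n)"
  shows "\<exists>g. continuous_on J g \<and> (\<forall>n\<in>{1..M}. \<forall>s\<in>{u (n - 1)..u n}. g s = G n s)"
proof -
  \<comment> \<open>The bound \<open>1 \<le> n\<close> assigns \<open>u 0\<close> to the first
    piece.\<close>
  define piece where "piece s = (LEAST n. 1 \<le> n \<and> s \<le> u n)" for s
  have eq: "G (piece s) s = G n s" if n: "n \<in> {1..M}" and s: "s \<in> {u (n - 1)..u n}" for n s
  proof -
    let ?m = "piece s"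
    have m: "1 \<le> ?m \<and> s \<le> u ?m"
      unfolding piece_def by (rule LeastI[of _ n]) (use n s in auto)
    have "?m \<le> n"
      unfolding piece_def by (rule Least_le) (use n s in auto)
    consider "?m = n" | "?m \<le> n - 1" using \<open>?m \<le> n\<close> by linarith
    then show ?thesis
    proof cases
      \<comment> \<open>A least index below \<open>n\<close> squeezes \<open>s\<close> to
        \<open>u (n - 1)\<close>; strict monotonicity of the nodes then leaves only the index
        \<open>n - 1\<close>, where \<open>join\<close> applies.\<close>
      case 2
      then have "u ?m \<le> u (n - 1)"
        using n by (intro nodes_le) auto
      then have "s = u ?m" "u ?m = u (n - 1)" using m s by auto
      have "\<not> ?m < n - 1"
        using nodes_less[of ?m "n - 1"] \<open>u ?m = u (n - 1)\<close> n by (metis atLeastAtMost_iff diff_le_self le_trans less_irrefl)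
      then have "?m = n - 1" using 2 by simp
      then show ?thesis
        using join[of ?m] m n \<open>s = u ?m\<close> by auto
    qed simp
  qed
  have "continuous_on (\<Union>n\<in>{1..M}. {u (n - 1)..u n}) (\<lambda>s. G (piece s) s)"
  proof (rule continuous_on_closed_Union)
    fix n assume n: "n \<in> {1..M}"
    show "continuous_on {u (n - 1)..u n} (\<lambda>s. G (piece s) s)"
      by (rule continuous_on_eq[OF cont[OF n]]) (use eq[OF n] in simp)
  qed auto
  then show ?thesis
    using eq unfolding J_eq_Union_pieces[symmetric] by blast
qed

end

section \<open>Scalar interpolants\<close>

text \<open>Banach's theorem will be applied to bounded continuous functions on the whole line.
  Freezing \<open>g\<close> at its end values outside the interval produces such a function.\<close>

lemma bcontfun_extension:
  fixes g :: "real \<Rightarrow> real"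
  assumes "continuous_on {a..b} g" and "a \<le> b"
  shows "\<exists>\<phi> :: real \<Rightarrow>\<^sub>C real. \<forall>s. \<phi> s = g (max a (min s b))"
proof -
  have clamp: "max a (min s b) \<in> {a..b}" for s
    using assms(2) by auto
  have "continuous_on UNIV (\<lambda>s. g (max a (min s b)))"
    by (rule continuous_on_compose2[OF assms(1)]) (use clamp in \<open>auto intro!: continuous_intros\<close>)
  moreover have "bounded (range (\<lambda>s. g (max a (min s b))))"
    by (rule bounded_subset[of "g ` {a..b}"])
      (use assms clamp in \<open>auto intro!: compact_imp_bounded compact_continuous_image\<close>)
  ultimately have "(\<lambda>s. g (max a (min s b))) \<in> bcontfun"
    by (simp add: bcontfun_def)
  then show ?thesis
    by (metis bcontfunE)
qed

context interpolation_nodes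
begin

text \<open>The interpolant is the fixed point of the Read-Bajraktarevic operator, which replaces the
  piece of a function over the \<open>n\<close>-th subinterval by the image of its whole graph under the
  \<open>n\<close>-th map.\<close>

lemma ex_scalar_interpolant:
  fixes z \<gamma> :: "nat \<Rightarrow> real" and q :: "nat \<Rightarrow> real \<Rightarrow> real"
  assumes \<gamma>: "\<And>n. n \<in> {1..M} \<Longrightarrow> \<bar>\<gamma> n\<bar> < 1"
    and q: "\<And>n. n \<in> {1..M} \<Longrightarrow> continuous_on J (q n)"
    and left: "\<And>n. n \<in> {1..M} \<Longrightarrow> \<gamma> n * z 0 + q n (u 0) = z (n - 1)"
    and right: "\<And>n. n \<in> {1..M} \<Longrightarrow> \<gamma> n * z M + q n (u M) = z n"
  shows "\<exists>g. continuous_on J g \<and> (\<forall>n\<in>{1..M}. \<forall>t\<in>J. g (L n t) = \<gamma> n * g t + q n t) \<and>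
    (\<forall>i\<in>{0..M}. g (u i) = z i)"
proof -
  \<comment> \<open>\<open>R n\<close> inverts \<open>L n\<close>: on the \<open>n\<close>-th piece
    the operator reads its argument at \<open>R n s\<close>.\<close>
  define R where "R n = L_map (u (n - 1)) (u n) (u 0) (u M)" for n
  have R_mem: "R n s \<in> J" if "n \<in> {1..M}" "s \<in> {u (n - 1)..u n}" for n s
    unfolding R_def using that piece_step endpoints by (intro L_map_mem) auto
  have R_left: "R n (u (n - 1)) = u 0" and R_right: "R n (u n) = u M" if "n \<in> {1..M}" for n
    using piece_step[OF that] by (auto simp: R_def)
  have R_L: "R n (L n t) = t" if "n \<in> {1..M}" for n t
    unfolding R_def using endpoints piece_step[OF that] by (intro L_map_inverse) auto
  \<comment> \<open>Only the two end values are prescribed; \<open>left\<close> and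
    \<open>right\<close> then make the new pieces agree at the inner nodes. The affine map merely
    encodes \<open>z 0\<close> and \<open>z M\<close> as singleton constraints at the ends, which
    are closed.\<close>
  define S :: "(real \<Rightarrow>\<^sub>C real) set"
    where "S = PiC {u 0, u M} (\<lambda>s. {L_map (u 0) (u M) (z 0) (z M) s})"
  have S_iff: "\<phi> \<in> S \<longleftrightarrow> \<phi> (u 0) = z 0 \<and> \<phi> (u M) = z M" for \<phi>
    using endpoints by (auto simp: S_def mem_PiC_iff)
  have "complete S"
    unfolding S_def complete_eq_closed by (intro closed_PiC) auto
  have "S \<noteq> {}"
  proof -
    obtain \<phi> :: "real \<Rightarrow>\<^sub>C real"
      where "\<And>s. \<phi> s = L_map (u 0) (u M) (z 0) (z M) (max (u 0) (min s (u M)))"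
      using bcontfun_extension[OF continuous_on_L_map less_imp_le[OF endpoints]] by metis
    then have "\<phi> \<in> S" using endpoints by (simp add: S_iff)
    then show ?thesis by blast
  qed
  \<comment> \<open>Existence of the operator's value \<open>\<psi>\<close> at
    \<open>\<phi>\<close>; choice then yields \<open>T\<close>. The clamping clause reduces the sup
    distance of two values of \<open>T\<close> to points of \<open>J\<close>.\<close>
  have "\<exists>\<psi>\<in>S. (\<forall>s. \<psi> s = \<psi> (max (u 0) (min s (u M)))) \<and>
      (\<forall>n\<in>{1..M}. \<forall>s\<in>{u (n - 1)..u n}. \<psi> s = \<gamma> n * \<phi> (R n s) + q n (R n s))"
    if "\<phi> \<in> S" for \<phi>
  proof -
    define G where "G n s = \<gamma> n * \<phi> (R n s) + q n (R n s)" for n s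
    have G_left: "G n (u (n - 1)) = z (n - 1)" and G_right: "G n (u n) = z n" if "n \<in> {1..M}" for n
      using left right R_left R_right that \<open>\<phi> \<in> S\<close> by (simp_all add: G_def S_iff)
    have "continuous_on {u (n - 1)..u n} (G n)" if n: "n \<in> {1..M}" for n
    proof -
      have R: "continuous_on {u (n - 1)..u n} (R n)"
        unfolding R_def by (rule continuous_on_L_map)
      have "continuous_on {u (n - 1)..u n} (\<lambda>s. q n (R n s))"
        by (rule continuous_on_compose2[OF q[OF n] R]) (use R_mem[OF n] in blast)
      moreover have "continuous_on {u (n - 1)..u n} (\<lambda>s. \<phi> (R n s))"
        by (rule continuous_on_compose2[OF continuous_on_apply_bcontfun[of UNIV] R]) simp
      ultimately show ?thesis
        unfolding G_def by (intro continuous_intros)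
    qed
    moreover have "G n (u n) = G (Suc n) (u n)" if "1 \<le> n" "n < M" for n
      using G_right[of n] G_left[of "Suc n"] that by simp
    ultimately obtain g where g: "continuous_on J g"
      "\<And>n s. n \<in> {1..M} \<Longrightarrow> s \<in> {u (n - 1)..u n} \<Longrightarrow> g s = G n s"
      using glue[of G] by blast
    obtain \<psi> :: "real \<Rightarrow>\<^sub>C real" where \<psi>: "\<And>s. \<psi> s = g (max (u 0) (min s (u M)))"
      using bcontfun_extension[OF g(1) less_imp_le[OF endpoints]] by metis
    have \<psi>G: "\<psi> s = G n s" if "n \<in> {1..M}" "s \<in> {u (n - 1)..u n}" for n s
    proof -
      have "s \<in> J" using that piece_subset by blast
      then show ?thesis using g(2)[OF that] by (simp add: \<psi> min_absorb1 max_absorb2)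
    qed
    have "\<psi> (u 0) = z 0" "\<psi> (u M) = z M"
      using \<psi>G[of 1 "u 0"] G_left[of 1] \<psi>G[of M "u M"] G_right[of M] two_le piece_step[of 1] piece_step[of M]
      by auto
    then have "\<psi> \<in> S" by (simp add: S_iff)
    moreover have "\<psi> s = \<psi> (max (u 0) (min s (u M)))" for s
      using endpoints by (simp add: \<psi>)
    ultimately show ?thesis
      using \<psi>G unfolding G_def by blast
  qed
  then obtain T where T_S: "\<And>\<phi>. \<phi> \<in> S \<Longrightarrow> T \<phi> \<in> S"
    and T_clamp: "\<And>\<phi> s. \<phi> \<in> S \<Longrightarrow> T \<phi> s = T \<phi> (max (u 0) (min s (u M)))"
    and T: "\<And>\<phi> n s. \<phi> \<in> S \<Longrightarrow> n \<in> {1..M} \<Longrightarrow> s \<in> {u (n - 1)..u n} \<Longrightarrow>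
      T \<phi> s = \<gamma> n * \<phi> (R n s) + q n (R n s)"
    by metis
  define c where "c = Max ((\<lambda>n. \<bar>\<gamma> n\<bar>) ` {1..M})"
  have ne: "(\<lambda>n. \<bar>\<gamma> n\<bar>) ` {1..M} \<noteq> {}" using two_le by auto
  have c: "\<bar>\<gamma> n\<bar> \<le> c" if "n \<in> {1..M}" for n
    unfolding c_def using that by (intro Max_ge) auto
  have "c < 1"
    unfolding c_def using \<gamma> ne by (subst Max_less_iff) auto
  have "0 \<le> c"
    using c[of 1] two_le by (simp add: order_trans[OF abs_ge_zero])
  have "\<exists>!\<phi>\<in>S. T \<phi> = \<phi>"
  proof (rule Banach_fix[OF \<open>complete S\<close> \<open>S \<noteq> {}\<close> \<open>0 \<le> c\<close> \<open>c < 1\<close>])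
    show "T ` S \<subseteq> S" using T_S by blast
    fix \<phi> \<psi> assume \<phi>\<psi>: "\<phi> \<in> S" "\<psi> \<in> S"
    show "dist (T \<phi>) (T \<psi>) \<le> c * dist \<phi> \<psi>"
    proof (rule dist_bound)
      fix s0
      define s where "s = max (u 0) (min s0 (u M))"
      have "s \<in> J" using endpoints by (auto simp: s_def)
      then obtain n where n: "n \<in> {1..M}" "s \<in> {u (n - 1)..u n}"
        using ex_piece by blast
      have "dist (T \<phi> s0) (T \<psi> s0) = dist (T \<phi> s) (T \<psi> s)"
        unfolding s_def using T_clamp \<phi>\<psi> by metis
      also have "\<dots> = \<bar>\<gamma> n\<bar> * dist (\<phi> (R n s)) (\<psi> (R n s))"
        using T[OF _ n] \<phi>\<psi> by (simp add: dist_real_def flip: abs_mult right_diff_distrib)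
      also have "\<dots> \<le> c * dist \<phi> \<psi>"
        using c[OF n(1)] \<open>0 \<le> c\<close> by (intro mult_mono dist_bounded) auto
      finally show "dist (T \<phi> s0) (T \<psi> s0) \<le> c * dist \<phi> \<psi>" .
    qed
  qed
  then obtain \<phi> where \<phi>: "\<phi> \<in> S" "T \<phi> = \<phi>" by blast
  have self_similar: "\<phi> (L n t) = \<gamma> n * \<phi> t + q n t" if "n \<in> {1..M}" "t \<in> J" for n t
  proof -
    have "L n t \<in> {u (n - 1)..u n}" using that L_image by blast
    then show ?thesis using T[OF \<phi>(1) that(1)] R_L[OF that(1)] \<phi>(2) by simp
  qed
  \<comment> \<open>For positive \<open>i\<close> the node \<open>u i\<close> is
    \<open>L i (u M)\<close>, so the fixed-point equation and \<open>right\<close> give its value;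
    the value at \<open>u 0\<close> comes from membership in \<open>S\<close>.\<close>
  have "\<phi> (u i) = z i" if "i \<in> {0..M}" for i
  proof (cases "i = 0")
    case True
    then show ?thesis using \<phi> S_iff by simp
  next
    case False
    then have "i \<in> {1..M}" using that by auto
    then show ?thesis
      using self_similar[of i "u M"] right[of i] \<phi>(1) endpoints by (simp add: S_iff)
  qed
  then show ?thesis
    using self_similar by (intro exI[of _ "apply_bcontfun \<phi>"]) auto
qed

section \<open>The graph as attractor\<close>

lemma graph_invariant:
  assumes cont: "continuous_on J f"
    and f: "\<And>n t. n \<in> {1..M} \<Longrightarrow> t \<in> J \<Longrightarrow> f (L n t) = F n t (f t)"
  shows "invariant_compact (J \<times> UNIV) ((\<lambda>n. pair_map (L n) (F n)) ` {1..M}) (graph_on J f)"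
proof -
  have graph: "graph_on J f = (\<lambda>t. (t, f t)) ` J"
    by (auto simp: graph_on_def)
  have "compact (graph_on J f)"
    unfolding graph by (intro compact_continuous_image continuous_intros cont compact_Icc)
  moreover have "pair_map (L n) (F n) ` graph_on J f = (\<lambda>t. (t, f t)) ` L n ` J" if "n \<in> {1..M}" for n
    using f[OF that] unfolding graph image_image by (intro image_cong) (auto simp: pair_map_def)
  then have "(\<Union>n\<in>{1..M}. pair_map (L n) (F n) ` graph_on J f) = graph_on J f"
    using J_eq_Union unfolding graph by (simp flip: image_UN)
  moreover have "graph_on J f \<noteq> {}" "graph_on J f \<subseteq> J \<times> UNIV"
    using endpoints unfolding graph by auto
  ultimately show ?thesis
    unfolding invariant_compact_def by simp
qed

theorem attractor_is_interpolating_graph: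
  fixes y z \<alpha> \<beta> \<gamma> :: "nat \<Rightarrow> real" and p q :: "nat \<Rightarrow> real \<Rightarrow> real"
  defines "F \<equiv> \<lambda>n. F_map (\<alpha> n) (\<beta> n) (\<gamma> n) (p n) (q n)"
  assumes par: "\<And>n. n \<in> {1..M} \<Longrightarrow> \<bar>\<alpha> n\<bar> < 1 \<and> \<bar>\<beta> n\<bar> + \<bar>\<gamma> n\<bar> < 1"
    and cont: "\<And>n. n \<in> {1..M} \<Longrightarrow> continuous_on J (p n) \<and> continuous_on J (q n)"
    and join: "\<And>n. n \<in> {1..M} \<Longrightarrow>
      F n (u 0) (y 0, z 0) = (y (n - 1), z (n - 1)) \<and> F n (u M) (y M, z M) = (y n, z n)"
  shows "\<exists>f. continuous_on J f \<and>
    is_attractor (J \<times> UNIV) ((\<lambda>n. pair_map (L n) (F n)) ` {1..M}) (graph_on J f) \<and>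
    (\<forall>i\<in>{0..M}. f (u i) = (y i, z i))"
proof -
  let ?W = "(\<lambda>n. pair_map (L n) (F n)) ` {1..M}"
  have \<gamma>: "\<bar>\<gamma> n\<bar> < 1" if "n \<in> {1..M}" for n
    using par[OF that] by auto
  obtain h where h: "continuous_on J h"
    "\<And>n t. n \<in> {1..M} \<Longrightarrow> t \<in> J \<Longrightarrow> h (L n t) = \<gamma> n * h t + q n t"
    "\<And>i. i \<in> {0..M} \<Longrightarrow> h (u i) = z i"
    using ex_scalar_interpolant[of \<gamma> q z] \<gamma> cont join by (auto simp: F_def F_map_def)
  \<comment> \<open>With \<open>h\<close> known, \<open>\<beta> n * h t + p n t\<close> takes the
    place of the inhomogeneity. The end values \<open>z 0\<close> and \<open>z M\<close> of
    \<open>h\<close> turn the join-up conditions into the scalar ones.\<close>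
  have "\<exists>g. continuous_on J g \<and>
      (\<forall>n\<in>{1..M}. \<forall>t\<in>J. g (L n t) = \<alpha> n * g t + (\<beta> n * h t + p n t)) \<and> (\<forall>i\<in>{0..M}. g (u i) = y i)"
    using par cont join h(1) h(3)[of 0] h(3)[of M]
    by (intro ex_scalar_interpolant) (auto simp: F_def F_map_def add.assoc intro!: continuous_intros)
  then obtain g where g: "continuous_on J g"
    "\<And>n t. n \<in> {1..M} \<Longrightarrow> t \<in> J \<Longrightarrow> g (L n t) = \<alpha> n * g t + (\<beta> n * h t + p n t)"
    "\<And>i. i \<in> {0..M} \<Longrightarrow> g (u i) = y i"
    by blast
  define f where "f = (\<lambda>t. (g t, h t))"
  have f_cont: "continuous_on J f"
    unfolding f_def by (intro continuous_intros g h)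
  have f_eq: "f (L n t) = F n t (f t)" if "n \<in> {1..M}" "t \<in> J" for n t
    using g(2) h(2) that by (simp add: f_def F_def F_map_def)
  \<comment> \<open>One metric must serve all maps: it is sheared by the interpolant itself, which
    satisfies \<open>f_eq\<close> for every \<open>n\<close>.\<close>
  have "contraction_wrt (J \<times> UNIV) (\<lambda>s t. l1_norm (shear f s - shear f t)) w" if w: "w \<in> ?W" for w
  proof -
    obtain n where n: "n \<in> {1..M}" "w = pair_map (L n) (F n)"
      using w by blast
    show ?thesis
      using par[OF n(1)] f_eq[OF n(1)] endpoints piece_step[OF n(1)] piece_length[OF n(1)]
      unfolding n(2) F_def by (intro contraction_pair_map) simp_all
  qed
  moreover have "w ` (J \<times> UNIV) \<subseteq> J \<times> UNIV" if w: "w \<in> ?W" for w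
  proof -
    obtain n where "n \<in> {1..M}" "w = pair_map (L n) (F n)"
      using w by blast
    then show ?thesis
      using L_in_J[of n] by (auto simp: pair_map_def simp del: atLeastAtMost_iff)
  qed
  ultimately have IFS: "is_IFS (J \<times> UNIV) ?W"
    unfolding is_IFS_def using equivalent_complete_metric_shear[OF f_cont closed_atLeastAtMost] by blast
  moreover have inv: "invariant_compact (J \<times> UNIV) ?W (graph_on J f)"
    using graph_invariant f_cont f_eq by blast
  ultimately have "is_attractor (J \<times> UNIV) ?W (graph_on J f)"
    unfolding is_attractor_def using invariant_compact_subset by blast
  moreover have "f (u i) = (y i, z i)" if "i \<in> {0..M}" for i
    using g(3) h(3) that by (simp add: f_def)
  ultimately show ?thesis
    using f_cont by blast
qed

end

section \<open>Insertion of a node\<close>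

definition insert_at :: "nat \<Rightarrow> 'a \<Rightarrow> (nat \<Rightarrow> 'a) \<Rightarrow> nat \<Rightarrow> 'a" where
  "insert_at k a s i = (if i < k then s i else if i = k then a else s (i - 1))"

text \<open>Inserting a node at position \<open>k\<close> splits the \<open>k\<close>-th map into the maps number \<open>k\<close> and
  \<open>Suc k\<close>, and shifts the numbers of the later maps by one.\<close>

definition split_at :: "nat \<Rightarrow> 'a \<Rightarrow> 'a \<Rightarrow> (nat \<Rightarrow> 'a) \<Rightarrow> nat \<Rightarrow> 'a" where
  "split_at k l r s n =
    (if n < k then s n else if n = k then l else if n = Suc k then r else s (n - 1))"

lemma insert_at_simps [simp]:
  "i < k \<Longrightarrow> insert_at k a s i = s i"
  "insert_at k a s k = a"
  "k \<le> i \<Longrightarrow> insert_at k a s (Suc i) = s i"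
  by (simp_all add: insert_at_def)

lemma split_at_simps [simp]:
  "n < k \<Longrightarrow> split_at k l r s n = s n"
  "split_at k l r s k = l"
  "split_at k l r s (Suc k) = r"
  "k < n \<Longrightarrow> split_at k l r s (Suc n) = s n"
  by (simp_all add: split_at_def)

lemma split_index_cases [consumes 2, case_names below left right above]:
  assumes "n \<in> {1..Suc N}" and "k \<in> {1..N}"
  obtains "n \<in> {1..N}" "n < k" | "n = k" | "n = Suc k"
    | m where "n = Suc m" "m \<in> {1..N}" "k < m"
proof -
  consider "n < k" | "n = k" | "n = Suc k" | "Suc k < n" by linarith
  then show ?thesis
  proof cases
    case 4
    then show ?thesis using assms that(4)[of "n - 1"] by auto
  qed (use assms that in auto)
qed

text \<open>\<open>W\<close> is the renumbered family and \<open>V\<close> the original one; this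
  recovers the original numbering, with the two new maps listed separately.\<close>

lemma image_split_index:
  assumes k: "k \<in> {1..N}"
    and below: "\<And>n. n \<in> {1..N} \<Longrightarrow> n < k \<Longrightarrow> W n = V n"
    and above: "\<And>n. n \<in> {1..N} \<Longrightarrow> k < n \<Longrightarrow> W (Suc n) = V n"
  shows "W ` {1..Suc N} = V ` ({1..N} - {k}) \<union> {W k, W (Suc k)}"
proof
  show "W ` {1..Suc N} \<subseteq> V ` ({1..N} - {k}) \<union> {W k, W (Suc k)}"
  proof
    fix w assume "w \<in> W ` {1..Suc N}"
    then obtain n where n: "n \<in> {1..Suc N}" and w: "w = W n" by blast
    from n k show "w \<in> V ` ({1..N} - {k}) \<union> {W k, W (Suc k)}"
      by (cases rule: split_index_cases) (use below above w in auto)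
  qed
  have "V n \<in> W ` {1..Suc N}" if "n \<in> {1..N}" "n \<noteq> k" for n
  proof (cases "n < k")
    case True
    then show ?thesis using that below[of n] by (intro image_eqI[of _ _ n]) auto
  next
    case False
    then show ?thesis using that above[of n] by (intro image_eqI[of _ _ "Suc n"]) auto
  qed
  moreover have "{W k, W (Suc k)} \<subseteq> W ` {1..Suc N}"
    using k by auto
  ultimately show "V ` ({1..N} - {k}) \<union> {W k, W (Suc k)} \<subseteq> W ` {1..Suc N}"
    by blast
qed

theorem theorem3p2:
  fixes N k :: nat
    and x y z \<alpha> \<beta> \<gamma> :: "nat \<Rightarrow> real"
    and p q :: "nat \<Rightarrow> real \<Rightarrow> real"
    and xh yh zh \<alpha>l \<beta>l \<gamma>l \<alpha>r \<beta>r \<gamma>r :: real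
    and pl ql pr qr :: "real \<Rightarrow> real"
    and I :: "real set"
    and L :: "nat \<Rightarrow> real \<Rightarrow> real" and Ll Lr :: "real \<Rightarrow> real"
    and F :: "nat \<Rightarrow> real \<Rightarrow> real \<times> real \<Rightarrow> real \<times> real"
    and Fl Fr :: "real \<Rightarrow> real \<times> real \<Rightarrow> real \<times> real"
  defines "I \<equiv> {x 0..x N}"
    and "L \<equiv> \<lambda>n. L_map (x 0) (x N) (x (n - 1)) (x n)"
    and "Ll \<equiv> L_map (x 0) (x N) (x (k - 1)) xh"
    and "Lr \<equiv> L_map (x 0) (x N) xh (x k)"
    and "F \<equiv> \<lambda>n. F_map (\<alpha> n) (\<beta> n) (\<gamma> n) (p n) (q n)"
    and "Fl \<equiv> F_map \<alpha>l \<beta>l \<gamma>l pl ql"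
    and "Fr \<equiv> F_map \<alpha>r \<beta>r \<gamma>r pr qr"
  assumes "N \<ge> 2"
    and "\<forall>i<N. x i < x (Suc i)"
    and "\<forall>n\<in>{1..N}. \<bar>\<alpha> n\<bar> < 1 \<and> \<bar>\<gamma> n\<bar> < 1 \<and> \<bar>\<beta> n\<bar> + \<bar>\<gamma> n\<bar> < 1"
    and "\<forall>n\<in>{1..N}. continuous_on I (p n) \<and> continuous_on I (q n)"
    and "\<forall>n\<in>{1..N}. F n (x 0) (y 0, z 0) = (y (n - 1), z (n - 1)) \<and>
                     F n (x N) (y N, z N) = (y n, z n)"
    and "k \<in> {1..N}" and "x (k - 1) < xh" and "xh < x k"
    and "\<bar>\<alpha>l\<bar> < 1" and "\<bar>\<gamma>l\<bar> < 1" and "\<bar>\<beta>l\<bar> + \<bar>\<gamma>l\<bar> < 1"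
    and "continuous_on I pl" and "continuous_on I ql"
    and "Fl (x 0) (y 0, z 0) = (y (k - 1), z (k - 1))" and "Fl (x N) (y N, z N) = (yh, zh)"
    and "\<bar>\<alpha>r\<bar> < 1" and "\<bar>\<gamma>r\<bar> < 1" and "\<bar>\<beta>r\<bar> + \<bar>\<gamma>r\<bar> < 1"
    and "continuous_on I pr" and "continuous_on I qr"
    and "Fr (x 0) (y 0, z 0) = (yh, zh)" and "Fr (x N) (y N, z N) = (y k, z k)"
  shows "\<exists>f :: real \<Rightarrow> real \<times> real.
           continuous_on I f \<and>
           is_attractor (I \<times> UNIV)
             ((\<lambda>n. pair_map (L n) (F n)) ` ({1..N} - {k}) \<union> {pair_map Ll Fl, pair_map Lr Fr})
             (graph_on I f) \<and>
           (\<forall>i\<in>{0..N}. f (x i) = (y i, z i)) \<and> f xh = (yh, zh)"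
proof -
  note x_step = assms(9) and k = assms(13) and xh = assms(14,15)
  note maps = assms(10-12) and left = assms(16-22) and right = assms(23-29)
  \<comment> \<open>The refined data form an ordinary system with \<open>Suc N\<close> maps, so the
    general result applies to them; what remains is index bookkeeping.\<close>
  define u Y Z where "u = insert_at k xh x" and "Y = insert_at k yh y" and "Z = insert_at k zh z"
  define A B C P Q where "A = split_at k \<alpha>l \<alpha>r \<alpha>" and "B = split_at k \<beta>l \<beta>r \<beta>"
    and "C = split_at k \<gamma>l \<gamma>r \<gamma>" and "P = split_at k pl pr p" and "Q = split_at k ql qr q"
  note node_defs = u_def Y_def Z_def and map_defs = A_def B_def C_def P_def Q_def
  have ends [simp]: "u 0 = x 0" "u (Suc N) = x N" "Y 0 = y 0" "Y (Suc N) = y N"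
    "Z 0 = z 0" "Z (Suc N) = z N"
    using k by (auto simp: node_defs)
  have before: "insert_at k a s (k - 1) = s (k - 1)" for a and s :: "nat \<Rightarrow> real"
    using k by simp
  have shift: "insert_at k a s n = s (n - 1)" if "k < n" for a n and s :: "nat \<Rightarrow> real"
    using that by (simp add: insert_at_def)
  interpret interpolation_nodes "Suc N" u
  proof
    show "2 \<le> Suc N" using \<open>N \<ge> 2\<close> by simp
    fix i assume "i < Suc N"
    \<comment> \<open>Only the two middle cases involve the new node \<open>xh\<close>; the last one
      compares old nodes with indices lowered by one.\<close>
    consider "Suc i < k" | "Suc i = k" | "i = k" | "k < i" by linarith
    then show "u i < u (Suc i)"
    proof cases
      case 4
      then show ?thesis
        using x_step[rule_format, of "i - 1"] \<open>i < Suc N\<close> by (simp add: u_def shift)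
    qed (use x_step xh k in \<open>auto simp: u_def\<close>)
  qed
  define G where "G n = F_map (A n) (B n) (C n) (P n) (Q n)" for n
  have J: "{u 0..u (Suc N)} = I" by (simp add: I_def)
  have "\<exists>f. continuous_on I f \<and>
      is_attractor (I \<times> UNIV) ((\<lambda>n. pair_map (L_map (u 0) (u (Suc N)) (u (n - 1)) (u n)) (G n)) ` {1..Suc N})
        (graph_on I f) \<and>
      (\<forall>i\<in>{0..Suc N}. f (u i) = (Y i, Z i))"
    unfolding J[symmetric] G_def
  proof (rule attractor_is_interpolating_graph)
    fix n assume n: "n \<in> {1..Suc N}"
    show "\<bar>A n\<bar> < 1 \<and> \<bar>B n\<bar> + \<bar>C n\<bar> < 1"
      using n k by (cases rule: split_index_cases) (use maps left right in \<open>auto simp: map_defs\<close>)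
    show "continuous_on {u 0..u (Suc N)} (P n) \<and> continuous_on {u 0..u (Suc N)} (Q n)"
      unfolding J using n k
      by (cases rule: split_index_cases) (use maps left right in \<open>simp_all add: map_defs\<close>)
    show "F_map (A n) (B n) (C n) (P n) (Q n) (u 0) (Y 0, Z 0) = (Y (n - 1), Z (n - 1)) \<and>
        F_map (A n) (B n) (C n) (P n) (Q n) (u (Suc N)) (Y (Suc N), Z (Suc N)) = (Y n, Z n)"
      using n k
    proof (cases rule: split_index_cases)
      case below
      then show ?thesis using maps(3) k by (simp add: F_def node_defs map_defs)
    next
      case left
      then show ?thesis
        using assms(21,22) before k by (simp add: Fl_def node_defs map_defs)
    next
      case right
      then show ?thesis
        using assms(28,29) k by (simp add: Fr_def node_defs map_defs)
    next
      case (above m)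
      then show ?thesis
        using maps(3) k by (simp add: F_def node_defs map_defs shift)
    qed
  qed
  then obtain f where f: "continuous_on I f"
    "is_attractor (I \<times> UNIV) ((\<lambda>n. pair_map (L_map (u 0) (u (Suc N)) (u (n - 1)) (u n)) (G n)) ` {1..Suc N})
      (graph_on I f)"
    "\<And>i. i \<in> {0..Suc N} \<Longrightarrow> f (u i) = (Y i, Z i)"
    by blast
  have "(\<lambda>n. pair_map (L_map (u 0) (u (Suc N)) (u (n - 1)) (u n)) (G n)) ` {1..Suc N} =
      (\<lambda>n. pair_map (L n) (F n)) ` ({1..N} - {k}) \<union> {pair_map Ll Fl, pair_map Lr Fr}"
  proof (subst image_split_index[OF k])
    show "pair_map (L_map (u 0) (u (Suc N)) (u (n - 1)) (u n)) (G n) = pair_map (L n) (F n)"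
      if "n < k" for n
      \<comment> \<open>The first \<open>simp\<close> settles the end nodes by \<open>ends\<close>;
        the second unfolds the remaining nodes and the map data.\<close>
      using that by (simp add: L_def F_def G_def node_defs[symmetric]) (simp add: node_defs map_defs)
    show "pair_map (L_map (u 0) (u (Suc N)) (u (Suc n - 1)) (u (Suc n))) (G (Suc n)) = pair_map (L n) (F n)"
      if "k < n" for n
      using that by (simp add: L_def F_def G_def) (simp add: node_defs map_defs shift)
    show "(\<lambda>n. pair_map (L n) (F n)) ` ({1..N} - {k}) \<union>
        {pair_map (L_map (u 0) (u (Suc N)) (u (k - 1)) (u k)) (G k),
         pair_map (L_map (u 0) (u (Suc N)) (u (Suc k - 1)) (u (Suc k))) (G (Suc k))} =
        (\<lambda>n. pair_map (L n) (F n)) ` ({1..N} - {k}) \<union> {pair_map Ll Fl, pair_map Lr Fr}"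
      using before by (simp add: Ll_def Lr_def Fl_def Fr_def G_def) (simp add: node_defs map_defs)
  qed
  \<comment> \<open>An old node keeps its index below \<open>k\<close> and otherwise sits at
    \<open>Suc i\<close>.\<close>
  moreover have "f (x i) = (y i, z i)" if "i \<in> {0..N}" for i
  proof (cases "i < k")
    case True
    then show ?thesis using f(3)[of i] that by (simp add: node_defs)
  next
    case False
    then show ?thesis using f(3)[of "Suc i"] that by (simp add: node_defs)
  qed
  moreover have "f xh = (yh, zh)"
    using f(3)[of k] k by (simp add: node_defs)
  ultimately show ?thesis
    using f(1,2) by auto
qed

end
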